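(* Let $N\ge 1$, $\theta\in\mathbb{R}$, $s\in\{0,1\}$, and let $\bm{k}=(k_1,\dots,k_N)\in\mathcal{W}$ with $k_j\neq 0$ for all $j$, so that $G(\theta,s,\bm{k})$ is a full-weight Weyl phase gadget acting on $N$ qutrits. Then $G(\theta,s,\bm{k})$ admits a circuit implementation using $2(N-1)$ $\mathrm{CX}$ gates and a single-qutrit gate; that is, $G(\theta,s,\bm{k})$ equals, as an operator on $(\mathbb{C}^3)^{\otimes N}$, a product of $2(N-1)$ $\mathrm{CX}$ gates (each acting on some ordered pair of distinct qutrits, where $\mathrm{CX}$ and $\mathrm{CX}^2$ each count as one $\mathrm{CX}$ gate) and one single-qutrit gate.
   Context: A qutrit has Hilbert space $\mathbb{C}^3$ with orthonormal computational basis $|0\rangle,|1\rangle,|2\rangle$; $N$ qutrits have Hilbert space $(\mathbb{C}^3)^{\otimes N}$. Let $i$ denote the imaginary unit and $\omega=e^{2\pi i/3}$. The Weyl-Heisenberg operator $Z$ is defined by $Z|j\rangle=\omega^j|j\rangle$. Define $\mathcal{W}=\{\bm{k}\in\mathbb{Z}_3^N\setminus\{\bm{0}\} : k_\ell=1 \text{ for } \ell=\max\{j:k_j\neq 0\}\}$, i.e. the last nonzero entry of $\bm{k}$ equals $1$. For $s\in\{0,1\}$ and $\bm{k}\in\mathcal{W}$ define the Hermitian operator $$W_{s,\bm{k}}=i^s\, Z^{k_1}\otimes Z^{k_2}\otimes\cdots\otimes Z^{k_N}+\mathrm{h.c.},$$ where $\mathrm{h.c.}$ denotes the Hermitian conjugate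 of the preceding term. The Weyl phase gadget is $G(\theta,s,\bm{k})=\exp(-i\theta W_{s,\bm{k}})$. It is called full-weight when $k_j\neq0$ for all $j$. The two-qutrit gate $\mathrm{CX}$ with control qutrit $a$ and target qutrit $b$ ($a\ne b$), written $\mathrm{CX}_{a,b}$, acts on computational basis states by $|x\rangle_a|y\rangle_b\mapsto|x\rangle_a|(x+y)\bmod 3\rangle_b$ and as the identity on the other qutrits. It satisfies $\mathrm{CX}^3=\mathbb{1}$, so $\mathrm{CX}^2=\mathrm{CX}^\dagger$. Counting convention: a nontrivial power $\mathrm{CX}_{a,b}^m$, $m\in\{1,2\}$, counts as one $\mathrm{CX}$ gate. Any ordered pair of distinct qutrits may be used. A single-qutrit gate is a unitary operator on $\mathbb{C}^3$ acting on one of the qutrits and as the identity on the others. *)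

theory Defs
  imports "HOL-Analysis.Analysis"
begin

(* The qutrits are the elements of a finite linearly ordered index type 'n, so N = CARD('n) >= 1.
   Computational basis states are labelled by 3 ^ 'n, i.e. by Z_3^N (the type 3 has arithmetic
   modulo 3), and (C^3)^{tensor N} is identified with complex ^ (3 ^ 'n).  In A $ x $ y the row
   (output) label is x and the column (input) label is y. *)

type_synonym 'n op = "complex ^ (3 ^ 'n) ^ (3 ^ 'n)"

definition cscale :: "complex \<Rightarrow> complex ^ 'a ^ 'b \<Rightarrow> complex ^ 'a ^ 'b" where
  "cscale c A = (\<chi> i j. c * A $ i $ j)"

definition hconj :: "complex ^ 'a ^ 'b \<Rightarrow> complex ^ 'b ^ 'a" where
  "hconj A = (\<chi> i j. cnj (A $ j $ i))"

definition unitary_mat :: "complex ^ 'a ^ 'a \<Rightarrow> bool" where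
  "unitary_mat U \<longleftrightarrow> hconj U ** U = mat 1 \<and> U ** hconj U = mat 1"

(* The library's power and exp are not available for the matrix product on vec types. *)
primrec mpow :: "complex ^ 'a ^ 'a \<Rightarrow> nat \<Rightarrow> complex ^ 'a ^ 'a" where
  "mpow A 0 = mat 1"
| "mpow A (Suc n) = A ** mpow A n"

definition mat_exp :: "complex ^ 'a ^ 'a \<Rightarrow> complex ^ 'a ^ 'a" where
  "mat_exp A = (\<Sum>n. mpow A n /\<^sub>R fact n)"

(* The series defining mat_exp always converges. *)
lemma summable_mat_exp:
  fixes A :: "complex ^ 'a ^ 'a"
  shows "summable (\<lambda>n. mpow A n /\<^sub>R fact n)"
proof -
  define S where "S B = (\<Sum>i\<in>UNIV. \<Sum>j\<in>UNIV. norm (B $ i $ j))" for B :: "complex ^ 'a ^ 'a"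
  have norm_le: "norm B \<le> S B" for B
  proof -
    have "norm B \<le> (\<Sum>i\<in>UNIV. norm (B $ i))"
      unfolding norm_vec_def[of B] by (rule L2_set_le_sum) auto
    also have "\<dots> \<le> S B"
      unfolding S_def norm_vec_def[of "B $ _"] by (intro sum_mono L2_set_le_sum) auto
    finally show ?thesis .
  qed
  have mult: "S (B ** C) \<le> S B * S C" for B C
  proof -
    have row: "(\<Sum>j\<in>UNIV. norm (C $ k $ j)) \<le> S C" for k
      unfolding S_def
      by (rule member_le_sum[of k UNIV "\<lambda>k. \<Sum>j\<in>UNIV. norm (C $ k $ j)"]) (auto intro: sum_nonneg)
    have "S (B ** C) \<le> (\<Sum>i\<in>UNIV. \<Sum>j\<in>UNIV. \<Sum>k\<in>UNIV. norm (B $ i $ k) * norm (C $ k $ j))"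
      unfolding S_def matrix_matrix_mult_def
      by (intro sum_mono) (auto intro!: order.trans[OF norm_sum] simp: norm_mult)
    also have "\<dots> = (\<Sum>i\<in>UNIV. \<Sum>k\<in>UNIV. norm (B $ i $ k) * (\<Sum>j\<in>UNIV. norm (C $ k $ j)))"
      unfolding sum_distrib_left by (intro sum.cong refl sum.swap)
    also have "\<dots> \<le> (\<Sum>i\<in>UNIV. \<Sum>k\<in>UNIV. norm (B $ i $ k) * S C)"
      by (intro sum_mono mult_left_mono row) auto
    also have "\<dots> = S B * S C"
      by (simp add: S_def[of B] sum_distrib_right)
    finally show ?thesis .
  qed
  have S0: "S B \<ge> 0" for B
    unfolding S_def by (intro sum_nonneg) auto
  have pow: "S (mpow A n) \<le> S (mat 1) * S A ^ n" for n
  proof (induction n)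
    case (Suc n)
    have "S (mpow A (Suc n)) \<le> S A * S (mpow A n)" using mult by simp
    also have "\<dots> \<le> S A * (S (mat 1) * S A ^ n)" by (intro mult_left_mono Suc S0)
    finally show ?case by (simp add: mult_ac)
  qed simp
  show ?thesis
  proof (rule summable_comparison_test')
    show "summable (\<lambda>n. S (mat 1) * (S A ^ n /\<^sub>R fact n))"
      by (intro summable_mult summable_exp_generic)
    fix n :: nat
    show "norm (mpow A n /\<^sub>R fact n) \<le> S (mat 1) * (S A ^ n /\<^sub>R fact n)"
      using order.trans[OF norm_le pow, of n]
      by (simp add: field_simps)
  qed
qed

(* The representative of a residue modulo 3 in {0, 1, 2}. *)
definition trit_nat :: "3 \<Rightarrow> nat" where
  "trit_nat x = nat (Rep_bit1 x)"

lemma trit_nat_simps [simp]: "trit_nat 0 = 0" "trit_nat 1 = 1" "trit_nat 2 = 2"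
  by (simp_all add: trit_nat_def bit1.Rep_0 bit1.Rep_1 bit1.Rep_numeral)

definition \<omega> :: complex where
  "\<omega> = exp (2 * of_real pi * \<i> / 3)"

definition weyl_Z :: "complex ^ 3 ^ 3" where
  "weyl_Z = (\<chi> x y. if x = y then \<omega> ^ trit_nat y else 0)"

lemma matrix_vector_mul_axis:
  fixes A :: "complex ^ 'a ^ 'b"
  shows "(A *v axis j 1) $ i = A $ i $ j"
proof -
  have "(A *v axis j 1) $ i = (\<Sum>l\<in>UNIV. if l = j then A $ i $ l else 0)"
    unfolding matrix_vector_mult_def axis_def vec_lambda_beta by (rule sum.cong) auto
  then show ?thesis by simp
qed

lemma weyl_Z_basis: "weyl_Z *v axis j 1 = \<omega> ^ trit_nat j *s axis j 1"
  by (rule vec_eq_iff[THEN iffD2]) (simp add: matrix_vector_mul_axis, simp add: weyl_Z_def axis_def)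

definition tensor_op :: "('n \<Rightarrow> complex ^ 3 ^ 3) \<Rightarrow> ('n::finite) op" where
  "tensor_op A = (\<chi> x y. \<Prod>j\<in>UNIV. A j $ (x $ j) $ (y $ j))"

definition weyl_labels :: "(3 ^ ('n::{finite,linorder})) set" where
  "weyl_labels = {k. k \<noteq> 0 \<and> k $ Max {j. k $ j \<noteq> 0} = 1}"

definition weyl_op :: "nat \<Rightarrow> 3 ^ 'n \<Rightarrow> ('n::finite) op" where
  "weyl_op s k =
     (let T = cscale (\<i> ^ s) (tensor_op (\<lambda>j. mpow weyl_Z (trit_nat (k $ j)))) in T + hconj T)"

definition weyl_gadget :: "real \<Rightarrow> nat \<Rightarrow> 3 ^ 'n \<Rightarrow> ('n::finite) op" where
  "weyl_gadget \<theta> s k = mat_exp (cscale (- \<i> * of_real \<theta>) (weyl_op s k))"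

definition CX_map :: "'n \<Rightarrow> 'n \<Rightarrow> 3 ^ 'n \<Rightarrow> 3 ^ ('n::finite)" where
  "CX_map a b x = (\<chi> j. if j = b then x $ a + x $ b else x $ j)"

definition CX :: "'n \<Rightarrow> 'n \<Rightarrow> ('n::finite) op" where
  "CX a b = (\<chi> x y. if x = CX_map a b y then 1 else 0)"

lemma CX_basis: "CX a b *v axis x 1 = axis (CX_map a b x) 1"
  by (rule vec_eq_iff[THEN iffD2]) (simp add: matrix_vector_mul_axis, simp add: CX_def axis_def)

definition CX_gates :: "('n::finite) op set" where
  "CX_gates = {mpow (CX a b) m | a b m. a \<noteq> b \<and> m \<in> {1, 2}}"

definition single_qutrit_gates :: "('n::finite) op set" where
  "single_qutrit_gates =
     {tensor_op (\<lambda>j. if j = a then U else mat 1) | a U. unitary_mat U}"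

definition op_prod :: "('n::finite) op list \<Rightarrow> 'n op" where
  "op_prod gs = foldr (**) gs (mat 1)"

end

(* In the computational basis the gadget is diagonal and its entry at x depends only on the
   linear form \<Sum>\<^sub>j k\<^sub>j x\<^sub>j over Z_3. Let a be the last qutrit, where k has entry 1. A diagonal gate on a
   has entries depending on x\<^sub>a; conjugating it by the k\<^sub>j-th power of CX with control j and target a
   replaces x\<^sub>a by x\<^sub>a + k\<^sub>j x\<^sub>j. Doing this for each j \<noteq> a costs two CX gates per qutrit. *)
theory Submission
  imports Defs
begin

definition diag_mat :: "('a \<Rightarrow> complex) \<Rightarrow> complex ^ 'a ^ 'a" where
  "diag_mat d = (\<chi> x y. if x = y then d y else 0)"

text \<open>The operator sending the basis state y to the basis state \<open>f y\<close>; a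
  permutation matrix when \<open>f\<close> is bijective.\<close>

definition map_mat :: "('a \<Rightarrow> 'a) \<Rightarrow> complex ^ 'a ^ 'a" where
  "map_mat f = (\<chi> x y. if x = f y then 1 else 0)"

lemma diag_mat_1: "diag_mat (\<lambda>_. 1) = mat 1"
  by (simp add: diag_mat_def mat_def)

lemma map_mat_id: "map_mat id = mat 1"
  by (simp add: map_mat_def mat_def)

lemma sum_delta_mult:
  fixes c :: "'b::semiring_0"
  shows "finite A \<Longrightarrow> (\<Sum>z\<in>A. f z * (if z = y then c else 0)) = (if y \<in> A then f y * c else 0)"
  by (simp add: if_distrib[of "(*) _"] cong: if_cong)

lemma diag_mat_mult: "diag_mat d ** diag_mat e = diag_mat (\<lambda>x. d x * e x)"
  by (simp add: vec_eq_iff matrix_matrix_mult_def diag_mat_def sum_delta_mult)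

lemma map_mat_mult: "map_mat f ** map_mat g = map_mat (f \<circ> g)"
  by (simp add: vec_eq_iff matrix_matrix_mult_def map_mat_def sum_delta_mult)

text \<open>Both sides send the basis state y to \<open>d (f y)\<close> times the basis state
  \<open>f y\<close>.\<close>

lemma diag_mat_map_mat: "diag_mat d ** map_mat f = map_mat f ** diag_mat (d \<circ> f)"
  by (auto simp: vec_eq_iff matrix_matrix_mult_def diag_mat_def map_mat_def sum_delta_mult)

lemma mpow_diag_mat: "mpow (diag_mat d) n = diag_mat (\<lambda>x. d x ^ n)"
  by (induction n) (simp_all add: diag_mat_1 diag_mat_mult)

lemma mpow_map_mat: "mpow (map_mat f) n = map_mat (f ^^ n)"
  by (induction n) (simp_all add: map_mat_id[unfolded id_def] map_mat_mult comp_def)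

text \<open>Moving \<open>map_mat f\<close> left past the diagonal factor cancels it against
  \<open>map_mat g\<close>. Conjugation thus only substitutes \<open>f\<close> into the phase
  function.\<close>

lemma conj_diag_mat:
  assumes "g \<circ> f = id"
  shows "map_mat g ** diag_mat d ** map_mat f = diag_mat (d \<circ> f)"
proof -
  have "map_mat g ** diag_mat d ** map_mat f = (map_mat g ** map_mat f) ** diag_mat (d \<circ> f)"
    by (simp add: diag_mat_map_mat flip: matrix_mul_assoc)
  then show ?thesis
    by (simp add: map_mat_mult assms map_mat_id)
qed

lemma hconj_diag_mat: "hconj (diag_mat d) = diag_mat (\<lambda>x. cnj (d x))"
  by (auto simp: vec_eq_iff hconj_def diag_mat_def)

lemma cscale_diag_mat: "cscale c (diag_mat d) = diag_mat (\<lambda>x. c * d x)"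
  by (auto simp: vec_eq_iff cscale_def diag_mat_def)

lemma diag_mat_add: "diag_mat d + diag_mat e = diag_mat (\<lambda>x. d x + e x)"
  by (auto simp: vec_eq_iff diag_mat_def)

text \<open>Reading off an entry is bounded linear, so it passes through the convergent series and
  leaves a scalar exponential series or zeros.\<close>

lemma mat_exp_diag_mat: "mat_exp (diag_mat d) = diag_mat (\<lambda>x. exp (d x))"
proof -
  have "mat_exp (diag_mat d) $ x $ y = diag_mat (\<lambda>x. exp (d x)) $ x $ y" for x y
  proof -
    have "bounded_linear (\<lambda>A :: complex ^ 'a ^ 'a. A $ x $ y)"
      using bounded_linear_compose[OF bounded_linear_vec_nth bounded_linear_vec_nth] .
    from bounded_linear.suminf[OF this summable_mat_exp]
    have "mat_exp (diag_mat d) $ x $ y = (\<Sum>n. (mpow (diag_mat d) n /\<^sub>R fact n) $ x $ y)"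
      by (simp add: mat_exp_def)
    also have "\<dots> = diag_mat (\<lambda>x. exp (d x)) $ x $ y"
      unfolding mpow_diag_mat by (simp add: diag_mat_def exp_def)
    finally show ?thesis .
  qed
  then show ?thesis by (simp add: vec_eq_iff)
qed

lemma unitary_diag_mat:
  assumes "\<And>x. norm (d x) = 1"
  shows "unitary_mat (diag_mat d)"
proof -
  have "cnj (d x) * d x = 1" "d x * cnj (d x) = 1" for x
    using assms[of x] by (simp_all add: complex_norm_square[symmetric] mult.commute[of "cnj _"])
  then show ?thesis
    by (simp add: unitary_mat_def hconj_diag_mat diag_mat_mult diag_mat_1)
qed

lemma tensor_op_diag_mat:
  "tensor_op (\<lambda>j. diag_mat (d j)) = diag_mat (\<lambda>x. \<Prod>j\<in>UNIV. d j (x $ j))"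
  by (auto simp: tensor_op_def diag_mat_def vec_eq_iff)

lemma trit_cases:
  obtains "x = (0::3)" | "x = 1" | "x = 2"
  using exhaust_3[of x] by force

lemma of_nat_trit_nat [simp]: "of_nat (trit_nat x) = x"
  by (cases x rule: trit_cases) simp_all

text \<open>Serves to invert a power of CX by a power with a natural exponent.\<close>

lemma of_nat_3_minus_trit_nat: "of_nat (3 - trit_nat x) = - x"
  by (cases x rule: trit_cases) simp_all

lemma omega_power_3: "\<omega> ^ 3 = 1"
proof -
  have "\<omega> ^ 3 = exp (of_nat 3 * (2 * of_real pi * \<i> / 3))"
    unfolding \<omega>_def by (rule exp_of_nat_mult[symmetric])
  also have "of_nat 3 * (2 * of_real pi * \<i> / 3) = 2 * of_real pi * \<i>"
    by simp
  finally show ?thesis by (simp only: exp_two_pi_i)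
qed

lemma trit_3_4: "(3::3) = 0" "(4::3) = 1"
  by simp_all

text \<open>A wraparound modulo 3 changes the exponent by 3, which is harmless as
  \<open>\<omega> ^ 3 = 1\<close>: this is a character of Z_3.\<close>

lemma omega_power_trit_add: "\<omega> ^ trit_nat (x + y) = \<omega> ^ trit_nat x * \<omega> ^ trit_nat y"
  using omega_power_3
  by (cases x rule: trit_cases; cases y rule: trit_cases)
     (simp_all add: trit_3_4 power2_eq_square power3_eq_cube algebra_simps)

lemma omega_power_trit_mult: "\<omega> ^ trit_nat (x * y) = (\<omega> ^ trit_nat y) ^ trit_nat x"
  using omega_power_3
  by (cases x rule: trit_cases; cases y rule: trit_cases)
     (simp_all add: trit_3_4 power2_eq_square power3_eq_cube algebra_simps)

lemma omega_power_trit_sum: "\<omega> ^ trit_nat (sum f A) = (\<Prod>j\<in>A. \<omega> ^ trit_nat (f j))"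
  by (induction A rule: infinite_finite_induct) (simp_all add: omega_power_trit_add)

text \<open>All tensor factors are diagonal, and the character property merges their entries into
  one power of \<omega>. Adding the conjugate doubles the real part.\<close>

lemma weyl_op_diag:
  "weyl_op s k = diag_mat (\<lambda>x. of_real (2 * Re (\<i> ^ s * \<omega> ^ trit_nat (\<Sum>j\<in>UNIV. k $ j * x $ j))))"
proof -
  have "tensor_op (\<lambda>j. mpow weyl_Z (trit_nat (k $ j))) =
      diag_mat (\<lambda>x. \<omega> ^ trit_nat (\<Sum>j\<in>UNIV. k $ j * x $ j))"
    by (simp add: weyl_Z_def flip: diag_mat_def)
       (simp add: mpow_diag_mat tensor_op_diag_mat omega_power_trit_sum omega_power_trit_mult)
  then show ?thesis
    by (simp only: weyl_op_def Let_def cscale_diag_mat hconj_diag_mat diag_mat_add complex_add_cnj)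
qed

lemma weyl_gadget_diag:
  "weyl_gadget \<theta> s k = diag_mat (\<lambda>x.
     cis (- \<theta> * (2 * Re (\<i> ^ s * \<omega> ^ trit_nat (\<Sum>j\<in>UNIV. k $ j * x $ j)))))"
  by (simp add: weyl_gadget_def weyl_op_diag cscale_diag_mat mat_exp_diag_mat cis_conv_exp mult_ac)

lemma CX_eq_map_mat: "CX a b = map_mat (CX_map a b)"
  by (simp add: CX_def map_mat_def)

text \<open>As the control differs from the target, it keeps its value, and every iteration adds the
  same \<open>x $ a\<close>.\<close>

lemma CX_map_funpow:
  assumes "a \<noteq> b"
  shows "(CX_map a b ^^ m) x = (\<chi> j. if j = b then of_nat m * x $ a + x $ b else x $ j)"
  using assms by (induction m) (auto simp: CX_map_def vec_eq_iff algebra_simps)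

lemma op_prod_append: "op_prod (xs @ ys) = op_prod xs ** op_prod ys"
  by (induction xs) (simp_all add: op_prod_def matrix_mul_assoc)

lemma diag_mat_single_qutrit_gate:
  assumes "\<And>y. norm (\<phi> y) = 1"
  shows "diag_mat (\<lambda>x :: 3 ^ 'n::finite. \<phi> (x $ a)) \<in> single_qutrit_gates"
proof -
  have "(\<lambda>j. if j = a then diag_mat \<phi> else mat 1) = (\<lambda>j. diag_mat (if j = a then \<phi> else (\<lambda>_. 1)))"
    by (auto simp: diag_mat_1)
  then have "tensor_op (\<lambda>j. if j = a then diag_mat \<phi> else mat 1) =
      diag_mat (\<lambda>x. \<Prod>j\<in>UNIV. (if j = a then \<phi> else (\<lambda>_. 1)) (x $ j))"
    by (simp only: tensor_op_diag_mat)
  also have "\<dots> = diag_mat (\<lambda>x. \<phi> (x $ a))"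
  proof -
    have "(\<Prod>j\<in>UNIV. (if j = a then \<phi> else (\<lambda>_. 1)) (x $ j)) =
        (\<Prod>j\<in>UNIV. if j = a then \<phi> (x $ j) else 1)" for x :: "3 ^ 'n"
      by (rule prod.cong) auto
    then show ?thesis by simp
  qed
  finally show ?thesis
    unfolding single_qutrit_gates_def using unitary_diag_mat[of \<phi>, OF assms]
    by (auto intro!: exI[of _ a] exI[of _ "diag_mat \<phi>"])
qed

text \<open>Induction on \<open>S\<close>: each new qutrit wraps the circuit in one more gate on
  either side. Nonzero \<open>k $ j\<close> makes these powers of CX nontrivial, so they belong to
  \<open>CX_gates\<close>.\<close>

lemma CX_conj_diag_mat:
  fixes k :: "3 ^ 'n::finite"
  assumes "finite S" "a \<notin> S" "\<And>j. j \<in> S \<Longrightarrow> k $ j \<noteq> 0"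
  shows "\<exists>us vs. set us \<subseteq> CX_gates \<and> set vs \<subseteq> CX_gates \<and>
      length us = card S \<and> length vs = card S \<and>
      op_prod us ** diag_mat (\<lambda>x. \<phi> (x $ a)) ** op_prod vs =
        diag_mat (\<lambda>x. \<phi> (x $ a + (\<Sum>j\<in>S. k $ j * x $ j)))"
  using assms
proof (induction S rule: finite_induct)
  case empty
  then show ?case by (intro exI[of _ "[]"]) (simp add: op_prod_def)
next
  case (insert i S)
  let ?d = "\<lambda>x :: 3 ^ 'n. \<phi> (x $ a + (\<Sum>j\<in>S. k $ j * x $ j))"
  from insert obtain us vs where
    sub: "set us \<subseteq> CX_gates" "set vs \<subseteq> CX_gates" and len: "length us = card S" "length vs = card S" and
    eq: "op_prod us ** diag_mat (\<lambda>x. \<phi> (x $ a)) ** op_prod vs = diag_mat ?d"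
    by auto
  define m where "m = trit_nat (k $ i)"
  have ia: "i \<noteq> a" using insert.prems by auto
  have m: "m \<in> {1, 2}" "3 - m \<in> {1, 2}"
    using insert.prems(2)[of i] by (cases "k $ i" rule: trit_cases; simp add: m_def)+
  have gates: "mpow (CX i a) m \<in> CX_gates" "mpow (CX i a) (3 - m) \<in> CX_gates"
    unfolding CX_gates_def using ia m by blast+
  \<comment> \<open>Together the two powers add \<open>3 * x $ i\<close>, which is 0 modulo
    3.\<close>
  have inv: "(CX_map i a ^^ (3 - m)) \<circ> (CX_map i a ^^ m) = id"
    using ia by (auto simp: fun_eq_iff vec_eq_iff CX_map_funpow m_def of_nat_3_minus_trit_nat)
  \<comment> \<open>The new gates go outermost, so the induction hypothesis collapses the inside to
    \<open>diag_mat ?d\<close>.\<close>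
  have "op_prod (mpow (CX i a) (3 - m) # us) ** diag_mat (\<lambda>x. \<phi> (x $ a)) **
        op_prod (vs @ [mpow (CX i a) m])
      = mpow (CX i a) (3 - m) ** diag_mat ?d ** mpow (CX i a) m"
    unfolding eq[symmetric] op_prod_append by (simp add: op_prod_def matrix_mul_assoc)
  also have "\<dots> = diag_mat (?d \<circ> (CX_map i a ^^ m))"
    unfolding CX_eq_map_mat mpow_map_mat by (rule conj_diag_mat[OF inv])
  also have "?d \<circ> (CX_map i a ^^ m) = (\<lambda>x. \<phi> (x $ a + (\<Sum>j\<in>insert i S. k $ j * x $ j)))"
  proof
    fix x :: "3 ^ 'n"
    \<comment> \<open>The map alters only coordinate \<open>a\<close>, which lies outside
      \<open>S\<close>; there it adds \<open>k $ i * x $ i\<close>, the missing summand.\<close>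
    have "(\<Sum>j\<in>S. k $ j * (CX_map i a ^^ m) x $ j) = (\<Sum>j\<in>S. k $ j * x $ j)"
      using insert.prems ia by (intro sum.cong) (auto simp: CX_map_funpow)
    then show "(?d \<circ> (CX_map i a ^^ m)) x = \<phi> (x $ a + (\<Sum>j\<in>insert i S. k $ j * x $ j))"
      using insert.hyps ia by (simp add: CX_map_funpow m_def algebra_simps)
  qed
  finally show ?case
    using sub len gates insert.hyps
    by (intro exI[of _ "mpow (CX i a) (3 - m) # us"] exI[of _ "vs @ [mpow (CX i a) m]"]) simp
qed

theorem proposition1:
  fixes \<theta> :: real and s :: nat and k :: "3 ^ ('n::{finite,linorder})"
  assumes "s \<in> {0, 1}"
    and "k \<in> weyl_labels"
    and "\<forall>j. k $ j \<noteq> 0"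
  shows "\<exists>us g vs.
      set us \<subseteq> CX_gates \<and> set vs \<subseteq> CX_gates \<and>
      length us + length vs = 2 * (CARD('n) - 1) \<and>
      g \<in> single_qutrit_gates \<and>
      weyl_gadget \<theta> s k = op_prod (us @ g # vs)"
proof -
  \<comment> \<open>The witness is the maximal index from \<open>weyl_labels\<close>. Its entry 1
    means that \<open>x $ a\<close> enters the linear form unscaled, matching the target of the CX
    gates.\<close>
  obtain a where ka: "k $ a = 1"
    using assms(2) by (auto simp: weyl_labels_def)
  \<comment> \<open>The gadget's phase as a function of the value \<open>y\<close> of the linear
    form.\<close>
  define \<phi> where "\<phi> y = cis (- \<theta> * (2 * Re (\<i> ^ s * \<omega> ^ trit_nat y)))" for y
  let ?g = "diag_mat (\<lambda>x. \<phi> (x $ a))"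
  obtain us vs where
    sub: "set us \<subseteq> CX_gates" "set vs \<subseteq> CX_gates" and
    len: "length us = card (UNIV - {a})" "length vs = card (UNIV - {a})" and
    eq: "op_prod us ** ?g ** op_prod vs =
      diag_mat (\<lambda>x. \<phi> (x $ a + (\<Sum>j\<in>UNIV - {a}. k $ j * x $ j)))"
    using CX_conj_diag_mat[of "UNIV - {a}" a k \<phi>] assms(3) by auto
  have "(\<Sum>j\<in>UNIV. k $ j * x $ j) = x $ a + (\<Sum>j\<in>UNIV - {a}. k $ j * x $ j)" for x
    by (subst sum.remove[of _ a]) (simp_all add: ka)
  then have "weyl_gadget \<theta> s k = op_prod us ** ?g ** op_prod vs"
    unfolding eq by (simp add: weyl_gadget_diag \<phi>_def)
  also have "\<dots> = op_prod (us @ ?g # vs)"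
    by (simp add: op_prod_append matrix_mul_assoc[symmetric]) (simp add: op_prod_def)
  finally have "weyl_gadget \<theta> s k = op_prod (us @ ?g # vs)" .
  moreover have "?g \<in> single_qutrit_gates"
    by (rule diag_mat_single_qutrit_gate) (simp add: \<phi>_def)
  \<comment> \<open>Each side has one gate per qutrit other than \<open>a\<close>.\<close>
  moreover have "length us + length vs = 2 * (CARD('n) - 1)"
    by (simp add: len)
  ultimately show ?thesis
    using sub by blast
qed

end
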